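(* Let $(X,D,K)$ be a metric type space and let $F:X\times X\to X$ and $g:X\to X$ be maps such that for all $x,y,u,v\in X$ $$D(F(x,y),F(u,v))\le\alpha_1D(gx,gu)+\alpha_2D(F(x,y),gx)+\alpha_3D(gy,gv)+\alpha_4D(F(u,v),gu)+\alpha_5D(F(x,y),gu)+\alpha_6D(F(u,v),gx),$$ where $\alpha_1,\dots,\alpha_6$ are nonnegative constants with $$2K(\alpha_1+\alpha_3)+(K+1)(\alpha_2+\alpha_4)+(K^2+K)(\alpha_5+\alpha_6)<2.$$ Suppose also that $F(X\times X)\subset g(X)$ and that $g(X)$ is complete. If $F$ and $g$ are $w$-compatible, then $F$ and $g$ have a unique coupled common fixed point, and it belongs to the diagonal, i.e. it is of the form $(z,z)$ with $z\in X$.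
   Context: A metric type space $(X,D,K)$ consists of a nonempty set $X$, a function $D:X\times X\to[0,\infty)$ and a constant $K\ge 1$ such that: (D1) $D(x,x)=0$ for all $x\in X$, and $D(x,y)=0$ implies $x=y$; (D2) $D(x,y)=D(y,x)$ for all $x,y\in X$; (D3) $D(x,y)\le K\big(D(x,z_1)+D(z_1,z_2)+\cdots+D(z_n,y)\big)$ for all $x,y,z_1,\dots,z_n\in X$, where $n\ge1$ is a fixed natural number. Convergence and Cauchy sequences are defined as for metric spaces: $x_m\to x$ means $D(x_m,x)\to0$; $(x_m)$ is Cauchy if $D(x_m,x_k)\to0$ as $m,k\to\infty$; $g(X)$ is complete if every Cauchy sequence in $g(X)$ converges to a point of $g(X)$. We write $gx$ for $g(x)$. An element $(x,y)\in X\times X$ is a coupled common fixed point of $F$ and $g$ if $F(x,y)=gx=x$ and $F(y,x)=gy=y$. The maps $F$ and $g$ are $w$-compatible if $g(F(x,y))=F(gx,gy)$ whenever $F(x,y)=g(x)$ and $F(y,x)=g(y)$. *)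

theory Defs
  imports Complex_Main "HOL-Library.FuncSet"
begin

text \<open>
  The carrier is an explicit set \<open>X\<close>; nothing is assumed about the values of \<open>D\<close>
  outside \<open>X \<times> X\<close>. In the relaxed polygonal inequality the chain
  \<open>x, z\<^sub>1, \<dots>, z\<^sub>n, y\<close> is encoded as \<open>z 0, z 1, \<dots>, z n, z (Suc n)\<close>.
\<close>

locale metric_type_space =
  fixes X :: "'a set" and D :: "'a \<Rightarrow> 'a \<Rightarrow> real" and K :: real and n :: nat
  assumes nonempty: "X \<noteq> {}"
    and K_ge_1: "1 \<le> K"
    and n_ge_1: "1 \<le> n"
    and nonneg: "\<And>x y. x \<in> X \<Longrightarrow> y \<in> X \<Longrightarrow> 0 \<le> D x y"
    and refl: "\<And>x. x \<in> X \<Longrightarrow> D x x = 0"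
    and eq_if_zero: "\<And>x y. x \<in> X \<Longrightarrow> y \<in> X \<Longrightarrow> D x y = 0 \<Longrightarrow> x = y"
    and symmetric: "\<And>x y. x \<in> X \<Longrightarrow> y \<in> X \<Longrightarrow> D x y = D y x"
    and polygonal: "\<And>z :: nat \<Rightarrow> 'a. (\<And>i. i \<le> Suc n \<Longrightarrow> z i \<in> X) \<Longrightarrow>
           D (z 0) (z (Suc n)) \<le> K * (\<Sum>i\<le>n. D (z i) (z (Suc i)))"

definition converges_to :: "('a \<Rightarrow> 'a \<Rightarrow> real) \<Rightarrow> (nat \<Rightarrow> 'a) \<Rightarrow> 'a \<Rightarrow> bool" where
  "converges_to D s l \<longleftrightarrow> (\<lambda>m. D (s m) l) \<longlonglongrightarrow> 0"

definition cauchy_seq :: "('a \<Rightarrow> 'a \<Rightarrow> real) \<Rightarrow> (nat \<Rightarrow> 'a) \<Rightarrow> bool" where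
  "cauchy_seq D s \<longleftrightarrow>
     ((\<lambda>(m, k). D (s m) (s k)) \<longlongrightarrow> 0) (sequentially \<times>\<^sub>F sequentially)"

definition complete_subset :: "('a \<Rightarrow> 'a \<Rightarrow> real) \<Rightarrow> 'a set \<Rightarrow> bool" where
  "complete_subset D A \<longleftrightarrow>
     (\<forall>s. (\<forall>m. s m \<in> A) \<and> cauchy_seq D s \<longrightarrow> (\<exists>l\<in>A. converges_to D s l))"

definition coupled_common_fixed_point ::
    "'a set \<Rightarrow> ('a \<times> 'a \<Rightarrow> 'a) \<Rightarrow> ('a \<Rightarrow> 'a) \<Rightarrow> 'a \<times> 'a \<Rightarrow> bool" where
  "coupled_common_fixed_point X F g p \<longleftrightarrow>
     p \<in> X \<times> X \<and>
     (case p of (x, y) \<Rightarrow> F (x, y) = g x \<and> g x = x \<and> F (y, x) = g y \<and> g y = y)"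

definition w_compatible :: "'a set \<Rightarrow> ('a \<times> 'a \<Rightarrow> 'a) \<Rightarrow> ('a \<Rightarrow> 'a) \<Rightarrow> bool" where
  "w_compatible X F g \<longleftrightarrow>
     (\<forall>x\<in>X. \<forall>y\<in>X. F (x, y) = g x \<and> F (y, x) = g y \<longrightarrow> g (F (x, y)) = F (g x, g y))"

end

theory Submission
  imports Defs
begin

text \<open>
  The coupled problem for \<open>F\<close> and \<open>g\<close> is an ordinary coincidence problem on \<open>X \<times> X\<close>, for the maps
  \<open>T (x, y) = (F (x, y), F (y, x))\<close> and \<open>G (x, y) = (g x, g y)\<close> and the distance that adds the
  distances of the two coordinates.  This distance is again of metric type, with the same \<open>K\<close>.  Adding
  the contractive condition for a pair of points, the one with the two points interchanged, and both
  of them with all coordinates swapped, one obtains a Hardy--Rogers condition with symmetric weights,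
  \<open>2 D(Tp, Tq) \<le> 2a D(Gp, Gq) + c (D(Tp, Gp) + D(Tq, Gq)) + e (D(Tp, Gq) + D(Tq, Gp))\<close>,
  where \<open>a = \<alpha>1 + \<alpha>3\<close>, \<open>c = \<alpha>2 + \<alpha>4\<close> and \<open>e = \<alpha>5 + \<alpha>6\<close>.  The numerical hypothesis becomes
  \<open>2Ka + (K+1)c + (K\<^sup>2+K)e < 2\<close>, which says exactly that \<open>\<rho> < 1 / K\<close> for the factor
  \<open>\<rho> = (2a + c + Ke) / (2 - c - Ke)\<close> by which successive distances shrink along \<open>(G p\<^sub>m)\<close> when
  \<open>G p\<^sub>m\<^sub>+\<^sub>1 = T p\<^sub>m\<close>.  That is what makes this sequence Cauchy although each
  use of the triangle inequality costs a factor \<open>K\<close> (\<open>cauchy_if_geometric_steps\<close>).  Its limit is a value \<open>G p = T p\<close>, and the condition admits only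
  one such value (\<open>coincidence_exists\<close>, \<open>coincidence_value_unique\<close>).

  The product problem is invariant under swapping coordinates, so the unique value is of the form
  \<open>(z, z)\<close>.  By \<open>w\<close>-compatibility \<open>(z, z)\<close> is itself a coincidence point; uniqueness
  of the value then gives \<open>g z = z\<close>.  Every coupled common fixed point is its own coincidence value, so
  there are no others.
\<close>

section \<open>Geometric sequences in metric type spaces\<close>

context metric_type_space
begin

lemma relaxed_triangle:
  assumes "x \<in> X" "y \<in> X" "z \<in> X"
  shows "D x z \<le> K * (D x y + D y z)"
proof -
  \<comment> \<open>A chain of the prescribed length that stays at \<open>z\<close> after two steps.\<close>
  define p where "p i = (if i = 0 then x else if i = 1 then y else z)" for i :: nat
  have "D (p 0) (p (Suc n)) \<le> K * (\<Sum>i\<le>n. D (p i) (p (Suc i)))"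
    by (rule polygonal) (use assms in \<open>auto simp: p_def\<close>)
  moreover have "(\<Sum>i\<le>n. D (p i) (p (Suc i))) = (\<Sum>i\<in>{0, 1}. D (p i) (p (Suc i)))"
    by (rule sum.mono_neutral_right) (use n_ge_1 refl assms in \<open>auto simp: p_def\<close>)
  ultimately show ?thesis
    using n_ge_1 by (simp add: p_def)
qed

text \<open>
  Splitting off one step at a time multiplies the \<open>i\<close>-th step by \<open>K ^ (i + 1)\<close>, so the bound is a
  geometric series of ratio \<open>K * \<rho>\<close>, hence the condition on \<open>\<rho>\<close>.
\<close>

lemma dist_le_if_geometric_steps:
  assumes s: "\<And>m. s m \<in> X" and step: "\<And>m. D (s m) (s (Suc m)) \<le> C * \<rho> ^ m"
    and "0 \<le> C" "0 \<le> \<rho>" "K * \<rho> < 1"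
  shows "(1 - K * \<rho>) * D (s m) (s (m + j)) \<le> K * C * \<rho> ^ m"
proof (induction j arbitrary: m)
  case 0
  then show ?case
    using assms K_ge_1 refl by simp
next
  case (Suc j)
  let ?r = "1 - K * \<rho>"
  have "D (s m) (s (m + Suc j)) \<le> K * (D (s m) (s (Suc m)) + D (s (Suc m)) (s (Suc m + j)))"
    using relaxed_triangle[OF s s s] by simp
  then have "?r * D (s m) (s (m + Suc j))
      \<le> ?r * (K * (D (s m) (s (Suc m)) + D (s (Suc m)) (s (Suc m + j))))"
    using assms by (intro mult_left_mono) auto
  also have "\<dots> = K * (?r * D (s m) (s (Suc m)) + ?r * D (s (Suc m)) (s (Suc m + j)))"
    by (simp add: algebra_simps)
  also have "\<dots> \<le> K * (?r * (C * \<rho> ^ m) + K * C * \<rho> ^ Suc m)"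
    using assms K_ge_1 by (intro mult_left_mono add_mono Suc.IH step) auto
  also have "\<dots> = K * C * \<rho> ^ m"
    by (simp add: algebra_simps)
  finally show ?case .
qed

lemma cauchy_if_geometric_steps:
  assumes s: "\<And>m. s m \<in> X" and step: "\<And>m. D (s m) (s (Suc m)) \<le> C * \<rho> ^ m"
    and "0 \<le> C" "0 \<le> \<rho>" "K * \<rho> < 1"
  shows "cauchy_seq D s"
proof -
  define B where "B = K * C / (1 - K * \<rho>)"
  have B: "0 \<le> B"
    using assms K_ge_1 by (simp add: B_def)
  have forward: "D (s m) (s k) \<le> B * \<rho> ^ m" if "m \<le> k" for m k
    using dist_le_if_geometric_steps[OF assms, of m "k - m"] that assms
    by (simp add: B_def field_simps)
  have le: "D (s m) (s k) \<le> B * \<rho> ^ m + B * \<rho> ^ k" for m k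
  proof (cases "m \<le> k")
    case True
    then show ?thesis
      using forward[of m k] B assms by (simp add: add_increasing2)
  next
    case False
    then show ?thesis
      using forward[of k m] B assms symmetric[OF s s, of m k] by (simp add: add_increasing)
  qed
  have "\<rho> \<le> K * \<rho>"
    using K_ge_1 assms by (simp add: mult_le_cancel_right1)
  then have "\<rho> < 1"
    using assms by linarith
  then have lim: "(\<lambda>m. B * \<rho> ^ m) \<longlonglongrightarrow> 0"
    using assms by (intro tendsto_mult_right_zero LIMSEQ_power_zero) auto
  have "((\<lambda>p. B * \<rho> ^ fst p) \<longlongrightarrow> 0) (sequentially \<times>\<^sub>F sequentially)"
    by (rule filterlim_compose[OF lim]) (simp add: filterlim_def filtermap_fst_prod_filter)
  moreover have "((\<lambda>p. B * \<rho> ^ snd p) \<longlongrightarrow> 0) (sequentially \<times>\<^sub>F sequentially)"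
    by (rule filterlim_compose[OF lim]) (simp add: filterlim_def filtermap_snd_prod_filter)
  ultimately have bound: "((\<lambda>p. B * \<rho> ^ fst p + B * \<rho> ^ snd p) \<longlongrightarrow> 0)
      (sequentially \<times>\<^sub>F sequentially)"
    by (rule tendsto_add_zero)
  show ?thesis
    unfolding cauchy_seq_def
    by (rule tendsto_sandwich[OF _ _ tendsto_const bound])
      (use le nonneg s in \<open>auto simp: split_beta\<close>)
qed

end

section \<open>Coincidences of a Hardy--Rogers pair\<close>

locale hardy_rogers_pair = metric_type_space X D K n
  for X :: "'a set" and D :: "'a \<Rightarrow> 'a \<Rightarrow> real" and K :: real and n :: nat +
  fixes T G :: "'a \<Rightarrow> 'a" and a c e :: real
  assumes G_closed: "\<And>p. p \<in> X \<Longrightarrow> G p \<in> X"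
    and range_subset: "T ` X \<subseteq> G ` X"
    and weights_nonneg: "0 \<le> a" "0 \<le> c" "0 \<le> e"
    and weights_small: "2 * K * a + (K + 1) * c + (K\<^sup>2 + K) * e < 2"
    and contraction: "\<And>p q. p \<in> X \<Longrightarrow> q \<in> X \<Longrightarrow>
          2 * D (T p) (T q) \<le> 2 * a * D (G p) (G q) + c * (D (T p) (G p) + D (T q) (G q))
            + e * (D (T p) (G q) + D (T q) (G p))"
begin

lemma T_closed:
  assumes "p \<in> X"
  shows "T p \<in> X"
proof -
  have "T p \<in> G ` X"
    using assms range_subset by (simp add: image_subset_iff)
  then show ?thesis
    using G_closed by (elim imageE) simp
qed

text \<open>
  Uniqueness of the coincidence value needs the first bound, the limit argument the second, and the
  decay of the iteration the other two.  The last one is the hypothesis itself, rearranged; the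
  others are weaker because the weights are nonnegative and \<open>1 \<le> K \<le> K\<^sup>2\<close>.
\<close>

lemma weights_bounds:
  shows "a + e < 1" and "K * c + K\<^sup>2 * e < 2" and "c + K * e < 2"
    and "K * ((2 * a + c + K * e) / (2 - c - K * e)) < 1"
proof -
  have K2: "K \<le> K\<^sup>2"
    using K_ge_1 by (simp add: power2_eq_square)
  have a: "a \<le> K * a" and c: "c \<le> K * c" and e: "e \<le> K * e" and e2: "K * e \<le> K\<^sup>2 * e"
    using mult_right_mono[OF K_ge_1, of a] mult_right_mono[OF K_ge_1, of c]
      mult_right_mono[OF K_ge_1, of e] mult_right_mono[OF K2, of e] weights_nonneg by simp_all
  have sum: "2 * (K * a) + (K * c + c) + (K\<^sup>2 * e + K * e) < 2"
    using weights_small by (simp add: algebra_simps)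
  show "a + e < 1" "K * c + K\<^sup>2 * e < 2"
    using sum a c e e2 weights_nonneg by linarith+
  show *: "c + K * e < 2"
    using sum a c e e2 weights_nonneg by linarith
  show "K * ((2 * a + c + K * e) / (2 - c - K * e)) < 1"
  proof -
    have "K * (2 * a + c + K * e) < 2 - c - K * e"
      using sum by (simp add: algebra_simps power2_eq_square)
    then show ?thesis
      using * by (simp add: divide_less_eq)
  qed
qed

lemma coincidence_value_unique:
  assumes "p \<in> X" "q \<in> X" "T p = G p" "T q = G q"
  shows "G p = G q"
proof -
  have pq: "G p \<in> X" "G q \<in> X"
    using assms G_closed by auto
  have "2 * D (G p) (G q) \<le> 2 * a * D (G p) (G q) + e * (D (G p) (G q) + D (G q) (G p))"
    using contraction[of p q] assms pq refl by simp
  then have "(1 - (a + e)) * D (G p) (G q) \<le> 0"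
    using symmetric[OF pq] by (simp add: algebra_simps)
  then have "D (G p) (G q) \<le> 0"
    using weights_bounds(1) by (simp add: mult_le_0_iff)
  then show ?thesis
    using nonneg[OF pq] by (intro eq_if_zero pq) linarith
qed

text \<open>
  One iteration step: the distance \<open>D (T q) (G p)\<close> skips a step of the sequence and is split by the
  triangle inequality, which produces the terms \<open>K * e\<close> on both sides of the recursion.
\<close>

lemma step_decay:
  assumes "p \<in> X" "q \<in> X" "G q = T p"
  shows "D (T p) (T q) \<le> (2 * a + c + K * e) / (2 - c - K * e) * D (G p) (T p)"
proof -
  let ?x = "D (G p) (T p)" and ?y = "D (T p) (T q)"
  have in_X: "G p \<in> X" "T p \<in> X" "T q \<in> X"
    using assms G_closed T_closed by auto
  have sym: "D (T p) (G p) = ?x" "D (T q) (T p) = ?y" "D (T q) (G p) = D (G p) (T q)"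
    using in_X symmetric by auto
  have "e * D (G p) (T q) \<le> e * (K * (?x + ?y))"
    using in_X by (intro mult_left_mono relaxed_triangle weights_nonneg)
  moreover have "2 * ?y \<le> 2 * a * ?x + c * (?x + ?y) + e * D (G p) (T q)"
    using contraction[of p q] assms in_X refl by (simp add: sym)
  ultimately have "(2 - c - K * e) * ?y \<le> (2 * a + c + K * e) * ?x"
    by (simp add: algebra_simps)
  then show ?thesis
    using weights_bounds(3) by (simp add: field_simps)
qed

text \<open>
  The distance need not be continuous, so one cannot pass to the limit inside \<open>D\<close>.  Instead, every
  distance to a term of the sequence is compared with the corresponding distance to \<open>G p\<close>;
  the total error \<open>E m\<close> tends to 0, and what remains is
  \<open>2 * D (T p) (G p) \<le> (K * c + K\<^sup>2 * e) * D (T p) (G p)\<close>, where the factor is less than 2.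
\<close>

lemma limit_is_coincidence:
  assumes p: "p \<in> X" and s: "\<And>m. s m \<in> X" "\<And>m. G (s (Suc m)) = T (s m)"
    and lim: "(\<lambda>m. D (G (s m)) (G p)) \<longlonglongrightarrow> 0"
  shows "T p = G p"
proof -
  define d where "d m = D (G (s m)) (G p)" for m
  define E where "E m = K * (2 * a * d m + c * (K * (d (Suc m) + d m)) + e * (K * d m + d (Suc m)))
    + 2 * K * d (Suc m)" for m
  let ?t = "D (T p) (G p)"
  have in_X: "G p \<in> X" "T p \<in> X" "\<And>m. G (s m) \<in> X"
    using p s(1) G_closed T_closed by auto
  have bound: "2 * ?t \<le> (K * c + K\<^sup>2 * e) * ?t + E m" for m
  proof -
    have sym: "D (G p) (G (s k)) = d k" for k
      using symmetric in_X by (simp add: d_def)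
    have "2 * D (T p) (T (s m)) \<le> 2 * a * D (G p) (G (s m))
        + c * (?t + D (T (s m)) (G (s m))) + e * (D (T p) (G (s m)) + D (T (s m)) (G p))"
      using p s(1) by (rule contraction)
    also have "\<dots> = 2 * a * d m
        + c * (?t + D (G (s (Suc m))) (G (s m))) + e * (D (T p) (G (s m)) + d (Suc m))"
      by (simp only: sym d_def s(2))
    also have "\<dots> \<le> 2 * a * d m + c * (?t + K * (d (Suc m) + d m))
        + e * (K * (?t + d m) + d (Suc m))"
    proof (intro add_mono mult_left_mono)
      show "D (G (s (Suc m))) (G (s m)) \<le> K * (d (Suc m) + d m)"
        using relaxed_triangle[OF in_X(3,1,3), of "Suc m" m] by (simp only: sym d_def)
      show "D (T p) (G (s m)) \<le> K * (?t + d m)"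
        using relaxed_triangle[OF in_X(2,1,3), of m] by (simp only: sym)
    qed (use weights_nonneg in auto)
    finally have "2 * D (T p) (T (s m)) \<le> 2 * a * d m
        + c * (?t + K * (d (Suc m) + d m)) + e * (K * (?t + d m) + d (Suc m))" .
    then have "K * (2 * D (T p) (T (s m))) \<le> K * (2 * a * d m
        + c * (?t + K * (d (Suc m) + d m)) + e * (K * (?t + d m) + d (Suc m)))"
      by (rule mult_left_mono) (use K_ge_1 in simp)
    moreover have "?t \<le> K * (D (T p) (T (s m)) + d (Suc m))"
      using relaxed_triangle[OF in_X(2,3,1), of "Suc m"] by (simp only: d_def s(2))
    ultimately have "2 * ?t \<le> K * (2 * a * d m + c * (?t + K * (d (Suc m) + d m))
        + e * (K * (?t + d m) + d (Suc m))) + 2 * K * d (Suc m)"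
      by (simp add: distrib_left)
    also have "\<dots> = (K * c + K\<^sup>2 * e) * ?t + E m"
      by (simp add: E_def algebra_simps power2_eq_square)
    finally show ?thesis .
  qed
  have "E \<longlonglongrightarrow> 0"
  proof -
    have d: "d \<longlonglongrightarrow> 0"
      using lim by (simp add: d_def[abs_def])
    have "E \<longlonglongrightarrow> K * (2 * a * 0 + c * (K * (0 + 0)) + e * (K * 0 + 0)) + 2 * K * 0"
      unfolding E_def[abs_def] by (intro tendsto_intros d LIMSEQ_Suc[OF d])
    then show ?thesis
      by simp
  qed
  then have "(\<lambda>m. (K * c + K\<^sup>2 * e) * ?t + E m) \<longlonglongrightarrow> (K * c + K\<^sup>2 * e) * ?t + 0"
    by (intro tendsto_add tendsto_const)
  then have "2 * ?t \<le> (K * c + K\<^sup>2 * e) * ?t + 0"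
    by (rule LIMSEQ_le_const) (use bound in blast)
  then have "(2 - (K * c + K\<^sup>2 * e)) * ?t \<le> 0"
    by (simp add: algebra_simps)
  then have "?t \<le> 0"
    using weights_bounds(2) by (simp add: mult_le_0_iff)
  then show ?thesis
    using nonneg[OF in_X(2,1)] by (intro eq_if_zero in_X) linarith
qed

theorem coincidence_exists:
  assumes complete: "complete_subset D (G ` X)"
  shows "\<exists>p\<in>X. T p = G p"
proof -
  define \<rho> where "\<rho> = (2 * a + c + K * e) / (2 - c - K * e)"
  have \<rho>: "0 \<le> \<rho>" "K * \<rho> < 1"
    using weights_bounds(3,4) weights_nonneg K_ge_1 by (auto simp: \<rho>_def)
  obtain p0 where p0: "p0 \<in> X"
    using nonempty by blast
  have "\<forall>p\<in>X. \<exists>q\<in>X. G q = T p"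
    using range_subset by force
  then obtain next_pt where next_pt: "\<And>p. p \<in> X \<Longrightarrow> next_pt p \<in> X \<and> G (next_pt p) = T p"
    by metis
  define s where "s m = (next_pt ^^ m) p0" for m
  have s: "s m \<in> X" for m
    by (induction m) (use p0 next_pt in \<open>auto simp: s_def\<close>)
  have Gs: "G (s (Suc m)) = T (s m)" for m
    using next_pt[OF s[of m]] by (simp add: s_def)
  have step: "D (G (s m)) (G (s (Suc m))) \<le> D (G (s 0)) (T (s 0)) * \<rho> ^ m" for m
  proof (induction m)
    case 0
    show ?case by (simp add: Gs)
  next
    case (Suc m)
    have "D (G (s (Suc m))) (G (s (Suc (Suc m)))) \<le> \<rho> * D (G (s m)) (G (s (Suc m)))"
      using step_decay[OF s s Gs] by (simp add: Gs \<rho>_def)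
    also have "\<dots> \<le> \<rho> * (D (G (s 0)) (T (s 0)) * \<rho> ^ m)"
      using \<rho> Suc.IH by (intro mult_left_mono)
    finally show ?case
      by (simp add: mult_ac)
  qed
  have "cauchy_seq D (\<lambda>m. G (s m))"
    by (rule cauchy_if_geometric_steps[OF _ step]) (use s G_closed T_closed nonneg \<rho> in auto)
  moreover have "\<forall>m. G (s m) \<in> G ` X"
    using s by simp
  ultimately have "\<exists>l\<in>G ` X. converges_to D (\<lambda>m. G (s m)) l"
    using complete[unfolded complete_subset_def, rule_format, of "\<lambda>m. G (s m)"] by simp
  then obtain p where p: "p \<in> X" "(\<lambda>m. D (G (s m)) (G p)) \<longlonglongrightarrow> 0"
    by (auto simp: converges_to_def)
  have "T p = G p"
    by (rule limit_is_coincidence[OF p(1) s Gs p(2)])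
  with p(1) show ?thesis ..
qed

end

section \<open>The product space\<close>

definition sum_dist :: "('a \<Rightarrow> 'a \<Rightarrow> real) \<Rightarrow> 'a \<times> 'a \<Rightarrow> 'a \<times> 'a \<Rightarrow> real" where
  "sum_dist D p q = D (fst p) (fst q) + D (snd p) (snd q)"

context metric_type_space
begin

lemma product_metric_type_space: "metric_type_space (X \<times> X) (sum_dist D) K n"
proof
  fix z :: "nat \<Rightarrow> 'a \<times> 'a"
  assume z: "\<And>i. i \<le> Suc n \<Longrightarrow> z i \<in> X \<times> X"
  have "D (fst (z 0)) (fst (z (Suc n))) \<le> K * (\<Sum>i\<le>n. D (fst (z i)) (fst (z (Suc i))))"
    by (rule polygonal) (use z in \<open>auto simp: mem_Times_iff\<close>)
  moreover have "D (snd (z 0)) (snd (z (Suc n))) \<le> K * (\<Sum>i\<le>n. D (snd (z i)) (snd (z (Suc i))))"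
    by (rule polygonal) (use z in \<open>auto simp: mem_Times_iff\<close>)
  ultimately show "sum_dist D (z 0) (z (Suc n)) \<le> K * (\<Sum>i\<le>n. sum_dist D (z i) (z (Suc i)))"
    by (simp add: sum_dist_def sum.distrib distrib_left)
next
  fix p q assume "p \<in> X \<times> X" "q \<in> X \<times> X" "sum_dist D p q = 0"
  then show "p = q"
    using nonneg eq_if_zero by (auto simp: sum_dist_def add_nonneg_eq_0_iff)
qed (use nonempty K_ge_1 n_ge_1 nonneg refl symmetric in \<open>auto simp: sum_dist_def\<close>)

lemma product_complete:
  assumes "A \<subseteq> X" and complete: "complete_subset D A"
  shows "complete_subset (sum_dist D) (A \<times> A)"
  unfolding complete_subset_def
proof (intro allI impI, elim conjE)
  fix s :: "nat \<Rightarrow> 'a \<times> 'a"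
  assume s: "\<forall>m. s m \<in> A \<times> A" and cauchy: "cauchy_seq (sum_dist D) s"
  have in_X: "fst (s m) \<in> X" "snd (s m) \<in> X" for m
    using s \<open>A \<subseteq> X\<close> by (auto simp: mem_Times_iff)
  have lim: "((\<lambda>(m, k). sum_dist D (s m) (s k)) \<longlongrightarrow> 0) (sequentially \<times>\<^sub>F sequentially)"
    using cauchy by (simp add: cauchy_seq_def)
  have "cauchy_seq D (\<lambda>m. fst (s m))"
    unfolding cauchy_seq_def
    by (rule tendsto_sandwich[OF _ _ tendsto_const lim])
      (use in_X nonneg in \<open>auto simp: sum_dist_def split_beta\<close>)
  moreover have "cauchy_seq D (\<lambda>m. snd (s m))"
    unfolding cauchy_seq_def
    by (rule tendsto_sandwich[OF _ _ tendsto_const lim])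
      (use in_X nonneg in \<open>auto simp: sum_dist_def split_beta\<close>)
  moreover have "\<forall>m. fst (s m) \<in> A" "\<forall>m. snd (s m) \<in> A"
    using s by (auto simp: mem_Times_iff)
  ultimately have "\<exists>l\<in>A. converges_to D (\<lambda>m. fst (s m)) l" "\<exists>l\<in>A. converges_to D (\<lambda>m. snd (s m)) l"
    using complete[unfolded complete_subset_def, rule_format, of "\<lambda>m. fst (s m)"]
      complete[unfolded complete_subset_def, rule_format, of "\<lambda>m. snd (s m)"] by simp_all
  then obtain l l' where l: "l \<in> A" "(\<lambda>m. D (fst (s m)) l) \<longlonglongrightarrow> 0"
      and l': "l' \<in> A" "(\<lambda>m. D (snd (s m)) l') \<longlonglongrightarrow> 0"
    by (auto simp: converges_to_def)
  have "converges_to (sum_dist D) s (l, l')"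
    using tendsto_add[OF l(2) l'(2)] by (simp add: converges_to_def sum_dist_def)
  then show "\<exists>l\<in>A \<times> A. converges_to (sum_dist D) s l"
    using l(1) l'(1) by blast
qed

end

section \<open>Coupled common fixed points\<close>

theorem theorem6p4:
  fixes X :: "'a set" and D :: "'a \<Rightarrow> 'a \<Rightarrow> real" and K :: real and n :: nat
    and F :: "'a \<times> 'a \<Rightarrow> 'a" and g :: "'a \<Rightarrow> 'a"
    and \<alpha>1 \<alpha>2 \<alpha>3 \<alpha>4 \<alpha>5 \<alpha>6 :: real
  assumes "metric_type_space X D K n"
    and "F \<in> X \<times> X \<rightarrow> X"
    and "g \<in> X \<rightarrow> X"
    and "0 \<le> \<alpha>1" "0 \<le> \<alpha>2" "0 \<le> \<alpha>3" "0 \<le> \<alpha>4" "0 \<le> \<alpha>5" "0 \<le> \<alpha>6"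
    and "2 * K * (\<alpha>1 + \<alpha>3) + (K + 1) * (\<alpha>2 + \<alpha>4) + (K\<^sup>2 + K) * (\<alpha>5 + \<alpha>6) < 2"
    and "\<And>x y u v. x \<in> X \<Longrightarrow> y \<in> X \<Longrightarrow> u \<in> X \<Longrightarrow> v \<in> X \<Longrightarrow>
           D (F (x, y)) (F (u, v)) \<le>
             \<alpha>1 * D (g x) (g u) + \<alpha>2 * D (F (x, y)) (g x) + \<alpha>3 * D (g y) (g v) +
             \<alpha>4 * D (F (u, v)) (g u) + \<alpha>5 * D (F (x, y)) (g u) + \<alpha>6 * D (F (u, v)) (g x)"
    and "F ` (X \<times> X) \<subseteq> g ` X"
    and "complete_subset D (g ` X)"
    and "w_compatible X F g"
  shows "(\<exists>!p. coupled_common_fixed_point X F g p) \<and>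
         (\<exists>z\<in>X. coupled_common_fixed_point X F g (z, z))"
proof -
  interpret metric_type_space X D K n
    by fact
  define T where "T p = (F p, F (snd p, fst p))" for p
  define G where "G p = (g (fst p), g (snd p))" for p
  have closed: "\<And>x y. x \<in> X \<Longrightarrow> y \<in> X \<Longrightarrow> F (x, y) \<in> X" "\<And>x. x \<in> X \<Longrightarrow> g x \<in> X"
    using assms(2,3) by auto
  interpret P: hardy_rogers_pair "X \<times> X" "sum_dist D" K n T G "\<alpha>1 + \<alpha>3" "\<alpha>2 + \<alpha>4" "\<alpha>5 + \<alpha>6"
  proof (intro hardy_rogers_pair.intro product_metric_type_space hardy_rogers_pair_axioms.intro)
    show "T ` (X \<times> X) \<subseteq> G ` (X \<times> X)"
    proof
      fix t assume "t \<in> T ` (X \<times> X)"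
      then obtain x y where "x \<in> X" "y \<in> X" and t: "t = (F (x, y), F (y, x))"
        by (auto simp: T_def)
      then have "F (x, y) \<in> g ` X" "F (y, x) \<in> g ` X"
        using assms(12) by auto
      then show "t \<in> G ` (X \<times> X)"
        by (force simp: G_def t)
    qed
  next
    fix p q assume "p \<in> X \<times> X" "q \<in> X \<times> X"
    then obtain x y u v where p: "p = (x, y)" "x \<in> X" "y \<in> X" and q: "q = (u, v)" "u \<in> X" "v \<in> X"
      by auto
    have sym: "D (F (u, v)) (F (x, y)) = D (F (x, y)) (F (u, v))"
      "D (F (v, u)) (F (y, x)) = D (F (y, x)) (F (v, u))"
      "D (g u) (g x) = D (g x) (g u)" "D (g v) (g y) = D (g y) (g v)"
      using p q closed symmetric by auto
    \<comment> \<open>Interchanging the two points averages the weights within the pairs \<open>\<alpha>2, \<alpha>4\<close> and \<open>\<alpha>5, \<alpha>6\<close>;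
      swapping the coordinates merges \<open>\<alpha>1\<close> with \<open>\<alpha>3\<close>.\<close>
    show "2 * sum_dist D (T p) (T q) \<le> 2 * (\<alpha>1 + \<alpha>3) * sum_dist D (G p) (G q)
        + (\<alpha>2 + \<alpha>4) * (sum_dist D (T p) (G p) + sum_dist D (T q) (G q))
        + (\<alpha>5 + \<alpha>6) * (sum_dist D (T p) (G q) + sum_dist D (T q) (G p))"
      using assms(11)[of x y u v] assms(11)[of y x v u] assms(11)[of u v x y] assms(11)[of v u y x]
        p q
      by (simp add: sum_dist_def T_def G_def sym algebra_simps)
  qed (use assms closed in \<open>auto simp: G_def\<close>)
  have "G ` (X \<times> X) = g ` X \<times> g ` X"
    by (force simp: G_def)
  then have "complete_subset (sum_dist D) (G ` (X \<times> X))"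
    using product_complete[OF _ assms(13)] closed(2) by (simp add: image_subset_iff)
  then obtain x y where xy: "x \<in> X" "y \<in> X" "F (x, y) = g x" "F (y, x) = g y"
    using P.coincidence_exists by (auto simp: T_def G_def)
  have unique: "g u = g x" if "u \<in> X" "v \<in> X" "F (u, v) = g u" "F (v, u) = g v" for u v
    using P.coincidence_value_unique[of "(u, v)" "(x, y)"] that xy by (simp add: T_def G_def)
  define z where "z = g x"
  have z: "z \<in> X"
    using xy closed by (simp add: z_def)
  \<comment> \<open>The swapped pair is also a coincidence point.\<close>
  have gy: "g y = z"
    using unique[of y x] xy by (simp add: z_def)
  have "g (F (x, y)) = F (g x, g y)"
    using assms(14) xy unfolding w_compatible_def by blast
  then have Fz: "F (z, z) = g z"
    using xy gy by (simp add: z_def)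
  then have gz: "g z = z"
    using unique[of z z] z by (simp add: z_def)
  have fixed: "coupled_common_fixed_point X F g (z, z)"
    using z Fz gz by (simp add: coupled_common_fixed_point_def)
  moreover have "p = (z, z)" if p: "coupled_common_fixed_point X F g p" for p
  proof -
    obtain u v where "p = (u, v)" "u \<in> X" "v \<in> X" "F (u, v) = g u" "g u = u"
        "F (v, u) = g v" "g v = v"
      using p by (auto simp: coupled_common_fixed_point_def)
    then show ?thesis
      using unique[of u v] unique[of v u] by (simp add: z_def)
  qed
  ultimately show ?thesis
    using z by blast
qed

end
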